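(* The system $$\begin{aligned} \partial_t w_1+(x+1)\partial_x w_1+(y+1)\partial_y w_1&=w_2w_4-w_1w_3-w_1,\\ \partial_t w_3+(x-1)\partial_x w_3+(y-1)\partial_y w_3&=w_2w_4-w_1w_3-w_3,\\ \partial_t w_2+(x+1)\partial_x w_2+(y-1)\partial_y w_2&=w_1w_3-w_2w_4-w_2,\\ \partial_t w_4+(x-1)\partial_x w_4+(y+1)\partial_y w_4&=w_1w_3-w_2w_4-w_4, \end{aligned}$$ for $w=(w_1,w_2,w_3,w_4)(t,x,y)$, $(x,y)\in\mathbb R^2$, admits no nontrivial positive bounded solution which is constant or periodic in time.
   Context: This is the two-dimensional Broadwell model written in rescaled (self-similar blow-up) variables. "Positive" means $w_i\ge0$ for $i=1,2,3,4$; "nontrivial" means not identically zero; "bounded" means that there is a constant $\kappa$ with $w_i\le\kappa$ for all $t,x,y$ and all $i$; "constant in time" means independent of $t$. Solutions are understood as continuous functions satisfying each equation along the characteristic curves of the corresponding linear transport operator. *)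

theory Defs
  imports "HOL-Analysis.Analysis"
begin

text \<open>
  A state \<open>w t z\<close> has the four components \<open>w t z $ 1, \<dots>, w t z $ 4\<close>, where \<open>z = (x, y)\<close>;
  time ranges over all of \<open>\<real>\<close>.
\<close>

text \<open>
  The operator \<open>\<partial>\<^sub>t + (x + a) \<partial>\<^sub>x + (y + b) \<partial>\<^sub>y\<close> has the integral curves \<open>t \<mapsto> (t, \<xi> t)\<close> with
  \<open>\<xi>' = \<xi> + (a, b)\<close>. As this equation is linear, every solution extends to all times, so it
  suffices to consider global curves.
\<close>
definition characteristic :: "real \<times> real \<Rightarrow> (real \<Rightarrow> real \<times> real) \<Rightarrow> bool" where
  "characteristic c \<xi> \<longleftrightarrow> (\<forall>t. (\<xi> has_vector_derivative (\<xi> t + c)) (at t))"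

definition solves_along_characteristics ::
  "real \<times> real \<Rightarrow> (real \<Rightarrow> real \<times> real \<Rightarrow> real) \<Rightarrow> (real \<Rightarrow> real \<times> real \<Rightarrow> real) \<Rightarrow> bool" where
  "solves_along_characteristics c u f \<longleftrightarrow>
    (\<forall>\<xi>. characteristic c \<xi> \<longrightarrow>
      (\<forall>t. ((\<lambda>s. u s (\<xi> s)) has_real_derivative f t (\<xi> t)) (at t)))"

definition rescaled_broadwell_solution :: "(real \<Rightarrow> real \<times> real \<Rightarrow> real ^ 4) \<Rightarrow> bool" where
  "rescaled_broadwell_solution w \<longleftrightarrow>
    continuous_on UNIV (\<lambda>(t, z). w t z) \<and>
    solves_along_characteristics (1, 1) (\<lambda>t z. w t z $ 1)
      (\<lambda>t z. w t z $ 2 * w t z $ 4 - w t z $ 1 * w t z $ 3 - w t z $ 1) \<and>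
    solves_along_characteristics (- 1, - 1) (\<lambda>t z. w t z $ 3)
      (\<lambda>t z. w t z $ 2 * w t z $ 4 - w t z $ 1 * w t z $ 3 - w t z $ 3) \<and>
    solves_along_characteristics (1, - 1) (\<lambda>t z. w t z $ 2)
      (\<lambda>t z. w t z $ 1 * w t z $ 3 - w t z $ 2 * w t z $ 4 - w t z $ 2) \<and>
    solves_along_characteristics (- 1, 1) (\<lambda>t z. w t z $ 4)
      (\<lambda>t z. w t z $ 1 * w t z $ 3 - w t z $ 2 * w t z $ 4 - w t z $ 4)"

definition constant_in_time :: "(real \<Rightarrow> 'a \<Rightarrow> 'b) \<Rightarrow> bool" where
  "constant_in_time w \<longleftrightarrow> (\<forall>s t z. w s z = w t z)"

definition periodic_in_time :: "(real \<Rightarrow> 'a \<Rightarrow> 'b) \<Rightarrow> bool" where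
  "periodic_in_time w \<longleftrightarrow> (\<exists>T>0. \<forall>t z. w (t + T) z = w t z)"

end

theory Submission
  imports Defs
begin

text \<open>
  On a moving line \<open>x = -1 + \<xi> e\<^sup>t\<close> the source terms of \<open>w\<^sub>1\<close> and \<open>w\<^sub>2\<close> cancel and the mass of
  \<open>w\<^sub>1 + w\<^sub>2\<close> on \<open>\<bar>y\<bar> \<le> R\<close> can only leave through the ends when \<open>R > 1\<close>, so it is nonincreasing.
  For \<open>\<xi> = 0\<close> the mass is periodic, hence constant, so \<open>w\<^sub>1\<close> and \<open>w\<^sub>2\<close> vanish on \<open>x = -1\<close>, \<open>\<bar>y\<bar> > 1\<close>.
  As \<open>w\<^sub>1\<close> decays at most exponentially along its characteristics, a zero propagates backwards in
  time, towards \<open>y = -1\<close>; likewise for \<open>w\<^sub>2\<close> towards \<open>y = 1\<close>. So \<open>w\<^sub>1\<close> and \<open>w\<^sub>2\<close> vanish on the whole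
  line \<open>x = -1\<close>. Any other moving line converges to it backwards in time, so by monotonicity and
  periodicity its mass is zero as well. Finally \<open>w\<^sub>1 = w\<^sub>2 = 0\<close> makes \<open>w\<^sub>3\<close> and \<open>w\<^sub>4\<close> grow exponentially
  backwards along characteristics unless they vanish.
\<close>

section \<open>Mass balance on an interval for a transported density\<close>

lemma continuous_on_uncurried:
  assumes "continuous_on UNIV (\<lambda>(x, y). f x y)" "continuous_on A g" "continuous_on A h"
  shows "continuous_on A (\<lambda>x. f (g x) (h x))"
  using continuous_on_compose2[OF assms(1) continuous_on_Pair[OF assms(2,3)]] by simp

text \<open>The integral is a function of time and endpoint. Its partial derivatives come from the
  Leibniz rule and the fundamental theorem of calculus; continuity of the latter gives a total
  derivative, and the chain rule along \<open>t \<mapsto> (t, b t)\<close> finishes.\<close>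

lemma has_real_derivative_integral_moving_endpoint:
  fixes P P' :: "real \<Rightarrow> real \<Rightarrow> real"
  assumes P: "continuous_on UNIV (\<lambda>(t, y). P t y)"
    and P': "continuous_on UNIV (\<lambda>(t, y). P' t y)"
    and deriv: "\<And>t y. ((\<lambda>t. P t y) has_real_derivative P' t y) (at t)"
    and b: "(b has_real_derivative b') (at t)" and L: "L < b t"
  shows "((\<lambda>t. integral {L..b t} (P t)) has_real_derivative
    integral {L..b t} (P' t) + P t (b t) * b') (at t)"
proof -
  have contP: "continuous_on A (P s)" for s A
    by (intro continuous_on_uncurried[OF P] continuous_intros)
  have lower: "((\<lambda>t. integral {L..y} (P t)) has_derivative (*) (integral {L..y} (P' s)))
      (at s within UNIV)" for s y
    using leibniz_rule_field_derivative[of UNIV L y P P' s] deriv contP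
      continuous_on_subset[OF P', of "UNIV \<times> {L..y}"]
    by (auto simp: has_field_derivative_def intro!: integrable_continuous_interval)
  \<comment> \<open>The total derivative rule needs this partial derivative as a bounded linear map,
    so that its continuity can be stated.\<close>
  have upper: "((\<lambda>y. integral {L..y} (P s)) has_derivative
      blinfun_apply (blinfun_mult_right (P s y))) (at y within {L<..})" if "y \<in> {L<..}" for s y
  proof -
    have "((\<lambda>y. integral {L..y} (P s)) has_real_derivative P s y) (at y within {L..y + 1})"
      using that by (intro integral_has_real_derivative contP) auto
    then have "((\<lambda>y. integral {L..y} (P s)) has_real_derivative P s y) (at y)"
      using that by (simp add: at_within_Icc_at)
    then show ?thesis
      by (auto simp: has_field_derivative_def intro: has_derivative_at_withinI)
  qed
  have "((\<lambda>(t, y). integral {L..y} (P t)) has_derivative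
      (\<lambda>(s, y). integral {L..b t} (P' t) * s + blinfun_mult_right (P t (b t)) y))
      (at (t, b t) within UNIV \<times> {L<..})"
  proof (rule has_derivative_partialsI[OF lower upper])
    have "continuous (at (t, b t)) (\<lambda>(t, y). P t y)"
      using P by (simp add: continuous_on_eq_continuous_at)
    then have "continuous (at (t, b t)) (\<lambda>z. blinfun_mult_right ((\<lambda>(t, y). P t y) z))"
      by (intro bounded_linear.continuous[OF bounded_linear_blinfun_mult_right])
    then show "continuous (at (t, b t) within UNIV \<times> {L<..})
        (\<lambda>(t, y). blinfun_mult_right (P t y))"
      by (simp add: case_prod_unfold continuous_at_imp_continuous_at_within)
  qed (use L in auto)
  then have "((\<lambda>(t, y). integral {L..y} (P t)) has_derivative
      (\<lambda>(s, y). integral {L..b t} (P' t) * s + P t (b t) * y)) (at (t, b t))"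
    using L by (subst (asm) at_within_open) (auto simp: open_Times)
  moreover have "((\<lambda>t. (t, b t)) has_derivative (\<lambda>s. (s, b' * s))) (at t)"
    using b by (auto simp: has_field_derivative_def intro!: has_derivative_Pair)
  ultimately have "((\<lambda>(t, y). integral {L..y} (P t)) \<circ> (\<lambda>t. (t, b t)) has_derivative
      (\<lambda>(s, y). integral {L..b t} (P' t) * s + P t (b t) * y) \<circ> (\<lambda>s. (s, b' * s))) (at t)"
    by (intro diff_chain_at) auto
  then show ?thesis
    by (auto simp: has_field_derivative_def o_def fun_eq_iff algebra_simps
        elim!: has_derivative_eq_rhs)
qed

lemma mult_exp_minus_cancel [simp]: "v * exp (- t) * exp t = v" for v t :: real
  by (simp add: mult.assoc flip: exp_add)

lemma integral_exp_substitution: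
  fixes f :: "real \<Rightarrow> real"
  assumes f: "continuous_on UNIV f" and "a \<le> b"
  shows "integral {(a + c) * exp (- t)..(b + c) * exp (- t)} (\<lambda>\<eta>. exp t * f (- c + \<eta> * exp t)) =
    integral {a..b} f"
proof -
  have "((\<lambda>\<eta>. exp t *\<^sub>R f (- c + \<eta> * exp t)) has_integral
      integral {- c + (a + c) * exp (- t) * exp t..- c + (b + c) * exp (- t) * exp t} f)
      {(a + c) * exp (- t)..(b + c) * exp (- t)}"
    using \<open>a \<le> b\<close>
    by (intro has_integral_substitution[where c = a and d = b] continuous_on_subset[OF f])
      (auto intro!: derivative_eq_intros simp: exp_minus field_simps)
  from integral_unique[OF this] show ?thesis
    by (simp only: mult_exp_minus_cancel real_scaleR_def minus_add_cancel add.commute[of _ c])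
qed

text \<open>In the label \<eta> with \<open>y = - c + \<eta> * exp t\<close> the transport becomes a
  plain time derivative, and the Jacobian \<open>exp t\<close> absorbs the damping
  \<open>- p\<close>. The fixed endpoints become moving labels, whose motion yields the boundary
  terms.\<close>

lemma has_real_derivative_integral_transport:
  fixes p S :: "real \<Rightarrow> real \<Rightarrow> real"
  assumes p: "continuous_on UNIV (\<lambda>(t, y). p t y)"
    and S: "continuous_on UNIV (\<lambda>(t, y). S t y)"
    and deriv: "\<And>\<eta> t. ((\<lambda>t. p t (- c + \<eta> * exp t)) has_real_derivative
      S t (- c + \<eta> * exp t) - p t (- c + \<eta> * exp t)) (at t)"
    and "a \<le> b"
  shows "((\<lambda>t. integral {a..b} (p t)) has_real_derivative
    integral {a..b} (S t) - (b + c) * p t b + (a + c) * p t a) (at t)"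
proof -
  define P where "P t \<eta> = exp t * p t (- c + \<eta> * exp t)" for t \<eta>
  define P' where "P' t \<eta> = exp t * S t (- c + \<eta> * exp t)" for t \<eta>
  define \<alpha> where "\<alpha> v t = (v + c) * exp (- t)" for v t
  \<comment> \<open>A fixed base point left of both endpoint labels turns an integral with two
    moving ends into a difference of two with one.\<close>
  define L where "L = \<alpha> a t - 1"
  have contP: "continuous_on UNIV (\<lambda>(t, y). P t y)"
    unfolding P_def case_prod_unfold
    by (intro continuous_intros continuous_on_uncurried[OF p])
  have contP': "continuous_on UNIV (\<lambda>(t, y). P' t y)"
    unfolding P'_def case_prod_unfold
    by (intro continuous_intros continuous_on_uncurried[OF S])
  have derivP: "((\<lambda>t. P t y) has_real_derivative P' t y) (at t)" for t y
    unfolding P_def P'_def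
    by (rule derivative_eq_intros deriv refl)+ (simp add: algebra_simps)
  have slice: "continuous_on A (h t)" if "continuous_on UNIV (\<lambda>(t, y). h t y)"
    for h :: "real \<Rightarrow> real \<Rightarrow> real" and A t
    by (intro continuous_on_uncurried[OF that] continuous_intros)
  have \<alpha>_mono: "\<alpha> a s \<le> \<alpha> b s" for s
    using \<open>a \<le> b\<close> by (simp add: \<alpha>_def)
  have \<alpha>': "(\<alpha> v has_real_derivative - \<alpha> v t) (at t)" for v
    unfolding \<alpha>_def by (auto intro!: derivative_eq_intros)
  have split: "integral {\<alpha> a s..\<alpha> b s} (h s) = integral {L..\<alpha> b s} (h s) - integral {L..\<alpha> a s} (h s)"
    if "L < \<alpha> a s" "continuous_on UNIV (\<lambda>(t, y). h t y)" for s and h :: "real \<Rightarrow> real \<Rightarrow> real"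
    using Henstock_Kurzweil_Integration.integral_combine[of L "\<alpha> a s" "\<alpha> b s" "h s"]
      integrable_continuous_interval[OF slice[OF that(2)]] that(1) \<alpha>_mono[of s] by simp
  have "L < \<alpha> a t" "L < \<alpha> b t"
    using \<alpha>_mono[of t] by (auto simp: L_def)
  then have "((\<lambda>s. integral {L..\<alpha> b s} (P s) - integral {L..\<alpha> a s} (P s)) has_real_derivative
      (integral {L..\<alpha> b t} (P' t) + P t (\<alpha> b t) * - \<alpha> b t) -
      (integral {L..\<alpha> a t} (P' t) + P t (\<alpha> a t) * - \<alpha> a t)) (at t)"
    by (intro DERIV_diff has_real_derivative_integral_moving_endpoint contP contP' derivP \<alpha>')
  also have "(integral {L..\<alpha> b t} (P' t) + P t (\<alpha> b t) * - \<alpha> b t) -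
      (integral {L..\<alpha> a t} (P' t) + P t (\<alpha> a t) * - \<alpha> a t) =
      integral {a..b} (S t) - (b + c) * p t b + (a + c) * p t a"
  proof -
    have "integral {\<alpha> a t..\<alpha> b t} (P' t) = integral {a..b} (S t)"
      using integral_exp_substitution[OF slice[OF S] \<open>a \<le> b\<close>, of c t]
      by (simp add: \<alpha>_def P'_def[abs_def])
    moreover have "P t (\<alpha> v t) * \<alpha> v t = (v + c) * p t v" for v
    proof -
      have "P t (\<alpha> v t) * \<alpha> v t = exp t * p t v * ((v + c) * exp (- t))"
        by (simp add: P_def \<alpha>_def)
      also have "\<dots> = (v + c) * p t v * exp (- t) * exp t"
        by (simp only: mult_ac)
      finally show ?thesis
        by simp
    qed
    ultimately show ?thesis
      using split[OF \<open>L < \<alpha> a t\<close> contP'] by simp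
  qed
  finally have D: "((\<lambda>s. integral {L..\<alpha> b s} (P s) - integral {L..\<alpha> a s} (P s)) has_real_derivative
      integral {a..b} (S t) - (b + c) * p t b + (a + c) * p t a) (at t)" .
  \<comment> \<open>The splitting at \<open>L\<close> is available only for times near
    \<open>t\<close>, which suffices for a derivative there.\<close>
  have "isCont (\<alpha> a) t"
    using \<alpha>' by (rule DERIV_isCont)
  then have "\<forall>\<^sub>F s in nhds t. L < \<alpha> a s"
    using \<open>L < \<alpha> a t\<close> order_tendstoD(1)[of "\<alpha> a" "\<alpha> a t" "nhds t" L]
    by (simp add: continuous_at_imp_continuous_at_within isCont_def tendsto_at_iff_tendsto_nhds)
  then have "\<forall>\<^sub>F s in nhds t. integral {L..\<alpha> b s} (P s) - integral {L..\<alpha> a s} (P s) =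
      integral {a..b} (p s)"
  proof eventually_elim
    case (elim s)
    have "integral {\<alpha> a s..\<alpha> b s} (P s) = integral {a..b} (p s)"
      using integral_exp_substitution[OF slice[OF p] \<open>a \<le> b\<close>, of c s]
      by (simp add: \<alpha>_def P_def[abs_def])
    then show ?case
      using split[OF elim contP] by simp
  qed
  with D show ?thesis
    by (rule iffD1[OF DERIV_cong_ev[OF refl _ refl], rotated])
qed

section \<open>Explicit characteristics and vanishing along them\<close>

lemma solves_along_characteristicsD:
  assumes "solves_along_characteristics (a, b) u f"
  shows "((\<lambda>t. u t (- a + \<xi> * exp t, - b + \<eta> * exp t)) has_real_derivative
    f t (- a + \<xi> * exp t, - b + \<eta> * exp t)) (at t)"
proof -
  have "characteristic (a, b) (\<lambda>t. (- a + \<xi> * exp t, - b + \<eta> * exp t))"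
    unfolding characteristic_def
    by (auto intro!: derivative_eq_intros simp flip: has_real_derivative_iff_has_vector_derivative)
  with assms show ?thesis
    unfolding solves_along_characteristics_def by blast
qed

text \<open>The function \<open>u r * exp (K * r)\<close> is nondecreasing and nonnegative.\<close>

lemma nonneg_zero_backwards:
  fixes u u' :: "real \<Rightarrow> real"
  assumes deriv: "\<And>t. (u has_real_derivative u' t) (at t)"
    and decay: "\<And>t. - K * u t \<le> u' t" and nonneg: "\<And>t. 0 \<le> u t"
    and "u t = 0" "s \<le> t"
  shows "u s = 0"
proof -
  have "u s * exp (K * s) \<le> u t * exp (K * t)"
  proof (rule DERIV_nonneg_imp_nondecreasing[OF \<open>s \<le> t\<close>])
    fix r
    have "((\<lambda>r. u r * exp (K * r)) has_real_derivative (u' r + K * u r) * exp (K * r)) (at r)"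
      by (rule derivative_eq_intros deriv refl)+ (simp add: algebra_simps)
    moreover have "0 \<le> (u' r + K * u r) * exp (K * r)"
      using decay[of r] by simp
    ultimately show "\<exists>y. ((\<lambda>r. u r * exp (K * r)) has_real_derivative y) (at r) \<and> 0 \<le> y"
      by blast
  qed
  then have "u s \<le> 0"
    using \<open>u t = 0\<close> by (simp add: mult_le_0_iff)
  with nonneg[of s] show ?thesis
    by simp
qed

text \<open>The product \<open>u s * exp s\<close> is constant, and boundedness of \<open>u\<close>
  forces it to tend to 0 as \<open>s\<close> tends to minus infinity.\<close>

lemma bounded_exp_decay_zero:
  fixes u :: "real \<Rightarrow> real"
  assumes deriv: "\<And>t. (u has_real_derivative - u t) (at t)" and bound: "\<And>t. \<bar>u t\<bar> \<le> K"
  shows "u t = 0"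
proof -
  have "((\<lambda>r. u r * exp r) has_real_derivative 0) (at r)" for r
    by (rule derivative_eq_intros deriv refl)+ simp
  then have const: "u s * exp s = u t * exp t" for s
    using DERIV_isconst_all[of "\<lambda>r. u r * exp r"] by blast
  have "\<bar>u t\<bar> * exp t \<le> K * exp s" for s
  proof -
    have "\<bar>u t\<bar> * exp t = \<bar>u s\<bar> * exp s"
      using const[of s] by (metis abs_exp_cancel abs_mult)
    also have "\<dots> \<le> K * exp s"
      by (simp add: bound)
    finally show ?thesis .
  qed
  moreover have "((\<lambda>s. K * exp s) \<longlongrightarrow> K * 0) at_bot"
    by (intro tendsto_intros exp_at_bot)
  ultimately have "\<bar>u t\<bar> * exp t \<le> K * 0"
    by (intro tendsto_lowerbound[of "\<lambda>s. K * exp s" _ at_bot]) auto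
  then show ?thesis
    by (simp add: mult_le_0_iff)
qed

section \<open>Periodic solutions of the Broadwell system\<close>

lemma rescaled_broadwell_solution_trivial:
  fixes w :: "real \<Rightarrow> real \<times> real \<Rightarrow> real ^ 4"
  assumes sol: "rescaled_broadwell_solution w" and nonneg: "\<And>t z i. 0 \<le> w t z $ i"
    and bound: "\<And>t z i. w t z $ i \<le> \<kappa>" and "T > 0" and periodic: "\<And>t z. w (t + T) z = w t z"
  shows "w t z = 0"
proof -
  define Q where "Q t z = w t z $ 2 * w t z $ 4 - w t z $ 1 * w t z $ 3" for t z
  note sol = sol[unfolded rescaled_broadwell_solution_def]
  have char1: "((\<lambda>t. w t (- 1 + \<xi> * exp t, - 1 + \<eta> * exp t) $ 1) has_real_derivative
      Q t (- 1 + \<xi> * exp t, - 1 + \<eta> * exp t) - w t (- 1 + \<xi> * exp t, - 1 + \<eta> * exp t) $ 1) (at t)"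
    for \<xi> \<eta> t
    using sol solves_along_characteristicsD[of 1 1 "\<lambda>t z. w t z $ 1"] unfolding Q_def by blast
  have char2: "((\<lambda>t. w t (- 1 + \<xi> * exp t, 1 + \<eta> * exp t) $ 2) has_real_derivative
      - Q t (- 1 + \<xi> * exp t, 1 + \<eta> * exp t) - w t (- 1 + \<xi> * exp t, 1 + \<eta> * exp t) $ 2) (at t)"
    for \<xi> \<eta> t
    using sol solves_along_characteristicsD[of 1 "- 1" "\<lambda>t z. w t z $ 2" _ \<xi> \<eta> t]
    unfolding Q_def by fastforce
  have cont: "continuous_on UNIV (\<lambda>x. w (f x) (g x) $ i)"
    if "continuous_on UNIV f" "continuous_on UNIV g"
    for f :: "real \<times> real \<Rightarrow> real" and g :: "real \<times> real \<Rightarrow> real \<times> real" and i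
    using sol that by (intro continuous_intros continuous_on_uncurried[of w]) auto
  have cont_slice: "continuous_on A (\<lambda>y. w t (x, y) $ i)" for A t x i
    using sol by (intro continuous_intros continuous_on_uncurried[of w]) auto

  define M where "M R x t = integral {- R..R} (\<lambda>y. w t (x, y) $ 1 + w t (x, y) $ 2)" for R x t
  \<comment> \<open>The \<open>y\<close>-velocities are \<open>y + 1\<close> for
    \<open>w\<^sub>1\<close> and \<open>y - 1\<close> for \<open>w\<^sub>2\<close>; the weights are
    the outward speeds at the two ends, all positive when \<open>R > 1\<close>.\<close>
  define flux where "flux R x t = (R + 1) * w t (x, R) $ 1 + (R - 1) * w t (x, - R) $ 1 +
    (R - 1) * w t (x, R) $ 2 + (R + 1) * w t (x, - R) $ 2" for R x t
  have M': "((\<lambda>t. M R (- 1 + \<xi> * exp t) t) has_real_derivative - flux R (- 1 + \<xi> * exp t) t) (at t)"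
    if "R > 1" for R \<xi> t
  proof -
    let ?x = "\<lambda>t. - 1 + \<xi> * exp t"
    have contQ: "continuous_on UNIV (\<lambda>(t, y). Q t (?x t, y))"
      unfolding Q_def case_prod_unfold by (intro continuous_intros cont)
    have contQ': "continuous_on UNIV (\<lambda>(t, y). - Q t (?x t, y))"
      using continuous_on_minus[OF contQ] by (simp add: case_prod_unfold)
    have contw: "continuous_on UNIV (\<lambda>(t, y). w t (?x t, y) $ i)" for i
      unfolding case_prod_unfold by (intro continuous_intros cont)
    have "- R \<le> R"
      using that by simp
    have "((\<lambda>t. integral {- R..R} (\<lambda>y. w t (?x t, y) $ 1)) has_real_derivative
        integral {- R..R} (\<lambda>y. Q t (?x t, y)) - (R + 1) * w t (?x t, R) $ 1
        + (- R + 1) * w t (?x t, - R) $ 1) (at t)"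
      by (rule has_real_derivative_integral_transport[OF contw contQ char1 \<open>- R \<le> R\<close>])
    \<comment> \<open>The form \<open>- (- 1)\<close> matches the transport lemma with
      \<open>c = - 1\<close>.\<close>
    moreover have "((\<lambda>t. w t (?x t, - (- 1) + \<eta> * exp t) $ 2) has_real_derivative
        - Q t (?x t, - (- 1) + \<eta> * exp t) - w t (?x t, - (- 1) + \<eta> * exp t) $ 2) (at t)"
      for \<eta> t
      using char2[of \<xi> \<eta> t] by simp
    note has_real_derivative_integral_transport[OF contw contQ' this \<open>- R \<le> R\<close>, of t]
    ultimately have "((\<lambda>t. integral {- R..R} (\<lambda>y. w t (?x t, y) $ 1) +
        integral {- R..R} (\<lambda>y. w t (?x t, y) $ 2)) has_real_derivative - flux R (?x t) t) (at t)"
      by (rule DERIV_add[THEN DERIV_cong]) (simp add: flux_def algebra_simps)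
    moreover have "integral {- R..R} (\<lambda>y. w t (?x t, y) $ 1) +
        integral {- R..R} (\<lambda>y. w t (?x t, y) $ 2) = M R (?x t) t" for t
      unfolding M_def
      by (intro integral_add[symmetric] integrable_continuous_interval cont_slice)
    ultimately show ?thesis
      by simp
  qed
  have flux_nonneg: "0 \<le> flux R x t" if "R > 1" for R x t
    using that nonneg unfolding flux_def by simp
  have M_antimono: "M R (- 1 + \<xi> * exp t) t \<le> M R (- 1 + \<xi> * exp s) s" if "R > 1" "s \<le> t" for R \<xi> s t
    using M'[OF \<open>R > 1\<close>] flux_nonneg[OF \<open>R > 1\<close>] \<open>s \<le> t\<close>
    by (intro DERIV_nonpos_imp_nonincreasing[of s t "\<lambda>t. M R (- 1 + \<xi> * exp t) t"])
      (auto intro!: exI)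
  have periodic_back: "w (t - real n * T) = w t" for t n
  proof (induction n)
    case (Suc n)
    have "w (t - real (Suc n) * T + T) = w (t - real n * T)"
      by (simp add: algebra_simps)
    with Suc periodic show ?case
      by (metis ext)
  qed simp

  have flux_zero: "flux R (- 1) t = 0" if "R > 1" for R t
  proof -
    have mono: "M R (- 1) t \<le> M R (- 1) s" if "s \<le> t" for s t
      using M_antimono[OF \<open>R > 1\<close> that, of 0] by simp
    have const: "M R (- 1) s = M R (- 1) t" if "s \<le> t" for s t
    proof -
      \<comment> \<open>Going back \<open>n\<close> periods from \<open>t\<close> reaches a time
        before \<open>s\<close>, where monotonicity bounds the mass at \<open>s\<close> by a value
        that equals the mass at \<open>t\<close>.\<close>
      obtain n :: nat where "t - s \<le> real n * T"
        using \<open>T > 0\<close> by (metis real_arch_simple pos_divide_le_eq)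
      then have "M R (- 1) s \<le> M R (- 1) (t - real n * T)"
        by (intro mono) simp
      also have "\<dots> = M R (- 1) t"
        by (simp add: M_def periodic_back)
      finally show ?thesis
        using mono[OF that] by simp
    qed
    have "M R (- 1) s = M R (- 1) t" for s
      using const[of s t] const[of t s] by linarith
    then have "(M R (- 1) has_real_derivative 0) (at t)"
      by (metis DERIV_const ext)
    moreover have "(M R (- 1) has_real_derivative - flux R (- 1) t) (at t)"
      using M'[OF that, of 0 t] by simp
    ultimately show ?thesis
      using DERIV_unique by fastforce
  qed
  have ends: "w t (- 1, R) $ 1 = 0" "w t (- 1, - R) $ 1 = 0" "w t (- 1, R) $ 2 = 0"
    "w t (- 1, - R) $ 2 = 0" if "R > 1" for R t
  proof -
    have "0 \<le> (R + 1) * w t (- 1, R) $ 1" "0 \<le> (R - 1) * w t (- 1, - R) $ 1"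
      "0 \<le> (R - 1) * w t (- 1, R) $ 2" "0 \<le> (R + 1) * w t (- 1, - R) $ 2"
      using that nonneg by simp_all
    then have "(R + 1) * w t (- 1, R) $ 1 = 0" "(R - 1) * w t (- 1, - R) $ 1 = 0"
      "(R - 1) * w t (- 1, R) $ 2 = 0" "(R + 1) * w t (- 1, - R) $ 2 = 0"
      using flux_zero[OF that, of t] unfolding flux_def by linarith+
    then show "w t (- 1, R) $ 1 = 0" "w t (- 1, - R) $ 1 = 0" "w t (- 1, R) $ 2 = 0"
      "w t (- 1, - R) $ 2 = 0"
      using that by simp_all
  qed
  \<comment> \<open>The gain products are nonnegative and the loss products are at most \<kappa>
    times the component itself.\<close>
  have decay: "- (\<kappa> + 1) * w t z $ 1 \<le> Q t z - w t z $ 1"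
    "- (\<kappa> + 1) * w t z $ 2 \<le> - Q t z - w t z $ 2" for t z
    using mult_left_mono[OF bound[of t z 3] nonneg[of t z 1]]
      mult_left_mono[OF bound[of t z 4] nonneg[of t z 2]]
      mult_nonneg_nonneg[OF nonneg[of t z 1] nonneg[of t z 3]]
      mult_nonneg_nonneg[OF nonneg[of t z 2] nonneg[of t z 4]]
    by (simp_all add: Q_def algebra_simps)
  \<comment> \<open>The characteristics \<open>y = \<mp>1 + \<eta> e\<^sup>t\<close> with \<open>y = \<pm>2\<close> at a later time \<open>s\<close> pass through \<open>y\<close> at time \<open>t\<close>.\<close>
  have mid1: "w t (- 1, y) $ 1 = 0" if "- 1 < y" "y \<le> 2" for t y
  proof -
    define \<eta> where "\<eta> = (y + 1) * exp (- t)"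
    define s where "s = t + ln (3 / (y + 1))"
    have "- 1 + \<eta> * exp s = 2" "- 1 + \<eta> * exp t = y"
      using that by (simp_all add: \<eta>_def s_def exp_add divide_simps flip: mult.assoc)
    moreover have "t \<le> s"
      using that by (simp add: s_def)
    ultimately show ?thesis
      using nonneg_zero_backwards[OF char1[of 0 \<eta>] decay(1) nonneg, of s t] ends(1)[of 2 s]
      by simp
  qed
  have mid2: "w t (- 1, y) $ 2 = 0" if "- 2 \<le> y" "y < 1" for t y
  proof -
    define \<eta> where "\<eta> = (y - 1) * exp (- t)"
    define s where "s = t + ln (3 / (1 - y))"
    have "1 + \<eta> * exp s = - 2" "1 + \<eta> * exp t = y"
      using that by (simp_all add: \<eta>_def s_def exp_add divide_simps flip: mult.assoc)
    moreover have "t \<le> s"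
      using that by (simp add: s_def)
    ultimately show ?thesis
      using nonneg_zero_backwards[OF char2[of 0 \<eta>] decay(2) nonneg, of s t] ends(4)[of 2 s]
      by (simp only: mult_zero_left add_0_right)
  qed
  have M_line_zero: "M R (- 1) t = 0" for R t
  proof -
    \<comment> \<open>\<open>mid1\<close> omits \<open>y = - 1\<close> and \<open>mid2\<close> omits
      \<open>y = 1\<close>; two points do not affect the integral.\<close>
    have "w t (- 1, y) $ 1 + w t (- 1, y) $ 2 = 0" if "y \<notin> {- 1, 1}" for y
      using mid1[of y t] mid2[of y t] ends[of y t] ends[of "- y" t] that
      by (cases "y < - 1"; cases "y > 1") auto
    then have "M R (- 1) t = integral {- R..R} (\<lambda>y. 0)"
      unfolding M_def by (intro integral_spike[of "{- 1, 1}"]) auto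
    then show ?thesis
      by simp
  qed
  have M_zero: "M R x t = 0" if "R > 1" for R x t
  proof (rule antisym)
    \<comment> \<open>This labels the moving line through \<open>x\<close> at time \<open>t\<close>;
      \<open>X n\<close> is its position \<open>n\<close> periods earlier, and by periodicity the
      mass there may be evaluated at time \<open>t\<close>.\<close>
    define \<xi> where "\<xi> = (x + 1) * exp (- t)"
    define X where "X n = - 1 + \<xi> * exp (t - real n * T)" for n
    have "M R x t \<le> M R (X n) t" for n
      using M_antimono[OF that, of "t - real n * T" t \<xi>] \<open>T > 0\<close>
      by (simp add: \<xi>_def X_def M_def periodic_back)
    moreover have "(\<lambda>n. M R (X n) t) \<longlonglongrightarrow> M R (- 1) t"
    proof -
      have "X = (\<lambda>n. - 1 + \<xi> * (exp t * exp (- T) ^ n))"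
        by (simp add: fun_eq_iff X_def flip: exp_add exp_of_nat_mult)
      moreover have "(\<lambda>n. - 1 + \<xi> * (exp t * exp (- T) ^ n)) \<longlonglongrightarrow> - 1 + \<xi> * (exp t * 0)"
        using \<open>T > 0\<close> by (intro tendsto_intros LIMSEQ_realpow_zero) auto
      ultimately have "X \<longlonglongrightarrow> - 1"
        by simp
      moreover have "continuous_on UNIV (\<lambda>x. M R x t)"
      proof -
        have "continuous_on UNIV (\<lambda>(x, y). w t (x, y) $ 1 + w t (x, y) $ 2)"
          unfolding case_prod_unfold by (intro continuous_intros cont)
        then show ?thesis
          unfolding M_def
          using integral_continuous_on_param[of UNIV "- R" R "\<lambda>x y. w t (x, y) $ 1 + w t (x, y) $ 2"]
          by (auto intro: continuous_on_subset)
      qed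
      ultimately show ?thesis
        by (auto simp: continuous_on_eq_continuous_at intro: isCont_tendsto_compose)
    qed
    ultimately show "M R x t \<le> 0"
      using M_line_zero[of R t] by (intro tendsto_lowerbound[of "\<lambda>n. M R (X n) t"]) auto
    show "0 \<le> M R x t"
      unfolding M_def
      by (intro integral_nonneg integrable_continuous_interval continuous_intros cont_slice)
        (simp add: nonneg)
  qed
  have w12: "w t z $ 1 = 0 \<and> w t z $ 2 = 0" for t z
  proof -
    obtain x y where z: "z = (x, y)"
      by (cases z)
    \<comment> \<open>This makes \<open>R > 1\<close> and puts \<open>y\<close> inside the interval;
      a nonnegative continuous function with zero integral then vanishes at
      \<open>y\<close>.\<close>
    define R where "R = \<bar>y\<bar> + 2"
    have "integral {- R..R} (\<lambda>y. w t (x, y) $ 1 + w t (x, y) $ 2) = 0"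
      using M_zero[of R x t] by (simp add: M_def R_def)
    then have "\<forall>y\<in>{- R..R}. w t (x, y) $ 1 + w t (x, y) $ 2 = 0"
      by (subst (asm) integral_eq_0_iff)
        (auto simp: R_def nonneg intro!: continuous_intros cont_slice)
    moreover have "y \<in> {- R..R}"
      by (auto simp: R_def)
    ultimately have "w t z $ 1 + w t z $ 2 = 0"
      unfolding z by blast
    then show ?thesis
      using nonneg[of t z 1] nonneg[of t z 2] by linarith
  qed
  have at_time: "\<exists>\<xi> \<eta>. z = (a + \<xi> * exp t, b + \<eta> * exp t)" for a b :: real
    by (rule exI[of _ "(fst z - a) * exp (- t)"], rule exI[of _ "(snd z - b) * exp (- t)"])
      (simp add: prod_eq_iff)
  have abs_bound: "\<bar>w t z $ i\<bar> \<le> \<kappa>" for t z i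
    using nonneg[of t z i] bound[of t z i] by simp
  \<comment> \<open>Both products contain \<open>w\<^sub>1\<close> or \<open>w\<^sub>2\<close>, so
    only the damping term is left along characteristics.\<close>
  have "w t z $ 3 = 0"
  proof -
    obtain \<xi> \<eta> where z: "z = (1 + \<xi> * exp t, 1 + \<eta> * exp t)"
      using at_time by blast
    have "((\<lambda>t. w t (1 + \<xi> * exp t, 1 + \<eta> * exp t) $ 3) has_real_derivative
        - (w t (1 + \<xi> * exp t, 1 + \<eta> * exp t) $ 3)) (at t)" for t
      using sol solves_along_characteristicsD[of "- 1" "- 1" "\<lambda>t z. w t z $ 3" _ \<xi> \<eta> t]
      by (fastforce simp: w12)
    from bounded_exp_decay_zero[OF this abs_bound] show ?thesis
      unfolding z .
  qed
  moreover have "w t z $ 4 = 0"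
  proof -
    obtain \<xi> \<eta> where z: "z = (1 + \<xi> * exp t, - 1 + \<eta> * exp t)"
      using at_time by blast
    have "((\<lambda>t. w t (1 + \<xi> * exp t, - 1 + \<eta> * exp t) $ 4) has_real_derivative
        - (w t (1 + \<xi> * exp t, - 1 + \<eta> * exp t) $ 4)) (at t)" for t
      using sol solves_along_characteristicsD[of "- 1" 1 "\<lambda>t z. w t z $ 4" _ \<xi> \<eta> t]
      by (fastforce simp: w12)
    from bounded_exp_decay_zero[OF this abs_bound] show ?thesis
      unfolding z .
  qed
  ultimately show ?thesis
    using w12[of t z] by (simp add: vec_eq_iff forall_4)
qed

theorem theorem5p1:
  "\<not> (\<exists>w :: real \<Rightarrow> real \<times> real \<Rightarrow> real ^ 4.
        rescaled_broadwell_solution w \<and>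
        (\<forall>t z i. 0 \<le> w t z $ i) \<and>
        (\<exists>\<kappa>. \<forall>t z i. w t z $ i \<le> \<kappa>) \<and>
        (\<exists>t z. w t z \<noteq> 0) \<and>
        (constant_in_time w \<or> periodic_in_time w))"
proof -
  \<comment> \<open>Any positive number is a period of a constant solution; 1 is chosen.\<close>
  have "periodic_in_time w" if "constant_in_time w" for w :: "real \<Rightarrow> real \<times> real \<Rightarrow> real ^ 4"
    using that unfolding constant_in_time_def periodic_in_time_def by (intro exI[of _ 1]) auto
  then show ?thesis
    unfolding periodic_in_time_def by (metis rescaled_broadwell_solution_trivial)
qed

end
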